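(* Consider two risk neutral buyers such that the pairs $(X_1,Y_1)$ and $(X_2,Y_2)$ are i.i.d., $Y_n$ is uniformly distributed on $[0,1]$, and, conditioned on $Y_n=y_n$, $X_n$ has pdf $$f_{X_n\mid Y_n=y_n}(x_n)=\begin{cases}1-y_n+6x_ny_n & \text{if }0\le x_n\le \tfrac13,\\ 1&\text{if }\tfrac13<x_n\le 1.\end{cases}$$ There exists an interval (of positive length) of choices for the investment $I$ such that, for every $I$ in this interval and for any realization $(y_1,y_2)\in[0,1]^2$ of the signal vector $(Y_1,Y_2)$ with $y_1\neq y_2$, the expected revenue to the seller, conditional on $(Y_1,Y_2)=(y_1,y_2)$, from the second price auction with bids restricted to debt securities is strictly higher than that from the second price auction with bids restricted to equity securities. Explicitly, with $i$ the buyer having the higher signal and $j$ the other buyer, $$\mathbb E\big[\min(X_i,b^d)\mid Y_i=y_i\big]>\mathbb E\big[b^eX_i\mid Y_i=y_i\big],$$ where $b^d$ and $b^e$ are the equilibrium debt and equity bids of buyer $j$ at signal $y_j$.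
   Context: Debt securities: $\phi(x,b)=\min(x,b)$, $b\in[0,1]$. Equity securities: $\phi(x,b)=bx$, $b\in[0,1-\delta]$, where $\delta>0$ is a constant small enough (given $I$) that $\mathbb E[\delta X_n-I\mid Y_n=y]\le 0$ for all $y\in[0,1]$. The winner of the auction must make a fixed investment $I$, obtains the value $X_n$, and pays $\phi(X_n,b')$ to the seller, where $b'$ is the second highest bid; the highest bidder wins. In the symmetric equilibrium of the second price auction, a buyer $j$ with signal $y_j$ bids the unique $b$ satisfying $\mathbb E[X_j-I-\phi(X_j,b)\mid Y_j=y_j]=0$ (risk neutral buyers, independent private values); thus $\mathbb E[X_j-I-\min(X_j,b^d)\mid Y_j=y_j]=0$ and $\mathbb E[X_j-I-b^eX_j\mid Y_j=y_j]=0$. This bid is increasing in the signal, so the buyer with the higher signal wins and pays the security bid of the other buyer. *)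

theory Defs
  imports "HOL-Probability.Probability"
begin

text \<open>
  \<open>cond_pdf M X Y f\<close>: for (almost) every \<open>y\<close>, the function \<open>f y\<close> is the pdf of \<open>X\<close> conditioned on
  \<open>Y = y\<close>, i.e. the joint law of \<open>(Y, X)\<close> has density \<open>f\<close> with respect to the product of the law
  of \<open>Y\<close> and Lebesgue measure.  The given \<open>f\<close> selects one version of the conditional law,
  so that \<open>cond_expect f g y\<close>, that is \<open>\<bbbE>[g(X) | Y = y]\<close>, is defined at every point \<open>y\<close>
  and not just almost everywhere.
\<close>

definition cond_pdf ::
  "'a measure \<Rightarrow> ('a \<Rightarrow> 'b::euclidean_space) \<Rightarrow> ('a \<Rightarrow> 'c::euclidean_space) \<Rightarrow> ('c \<Rightarrow> 'b \<Rightarrow> real) \<Rightarrow> bool"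
where
  "cond_pdf M X Y f \<longleftrightarrow>
     X \<in> borel_measurable M \<and> Y \<in> borel_measurable M \<and>
     case_prod f \<in> borel_measurable borel \<and>
     (AE y in distr M borel Y. \<forall>x. 0 \<le> f y x) \<and>
     distr M borel (\<lambda>\<omega>. (Y \<omega>, X \<omega>)) =
       density (distr M borel Y \<Otimes>\<^sub>M lborel) (\<lambda>(y, x). ennreal (f y x))"

definition cond_expect ::
  "('c \<Rightarrow> 'b::euclidean_space \<Rightarrow> real) \<Rightarrow> ('b \<Rightarrow> real) \<Rightarrow> 'c \<Rightarrow> real"
where
  "cond_expect f g y = (\<integral>x. g x * f y x \<partial>lborel)"

text \<open>
  Conditional pdf of \<open>(X\<^sub>1, X\<^sub>2)\<close> given \<open>(Y\<^sub>1, Y\<^sub>2)\<close> when the pairs \<open>(X\<^sub>n, Y\<^sub>n)\<close> are independent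
  with the same conditional pdf \<open>f\<close>; the lemma \<open>cond_pdf_pair\<close> justifies it.
\<close>

definition pair_pdf :: "('c \<Rightarrow> 'b \<Rightarrow> real) \<Rightarrow> 'c \<times> 'c \<Rightarrow> 'b \<times> 'b \<Rightarrow> real" where
  "pair_pdf f = (\<lambda>(y1, y2) (x1, x2). f y1 x1 * f y2 x2)"

definition debt :: "real \<Rightarrow> real \<Rightarrow> real" where
  "debt x b = min x b"

definition equity :: "real \<Rightarrow> real \<Rightarrow> real" where
  "equity x b = b * x"

definition debt_bids :: "real set" where
  "debt_bids = {0..1}"

definition equity_bids :: "real \<Rightarrow> real set" where
  "equity_bids \<delta> = {0..1 - \<delta>}"

text \<open>
  In the following, \<open>f\<close> is the conditional pdf of the value given the signal, \<open>\<phi>\<close> the security,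
  \<open>B\<close> the set of admissible bids, \<open>I\<close> the investment and \<open>y\<close> the signal of a buyer.
\<close>

definition zero_profit_bid ::
  "(real \<Rightarrow> real \<Rightarrow> real) \<Rightarrow> (real \<Rightarrow> real \<Rightarrow> real) \<Rightarrow> real set \<Rightarrow> real \<Rightarrow> real \<Rightarrow> real \<Rightarrow> bool"
where
  "zero_profit_bid f \<phi> B I y b \<longleftrightarrow> b \<in> B \<and> cond_expect f (\<lambda>x. x - I - \<phi> x b) y = 0"

definition equilibrium_bid ::
  "(real \<Rightarrow> real \<Rightarrow> real) \<Rightarrow> (real \<Rightarrow> real \<Rightarrow> real) \<Rightarrow> real set \<Rightarrow> real \<Rightarrow> real \<Rightarrow> real"
where
  "equilibrium_bid f \<phi> B I y = (THE b. zero_profit_bid f \<phi> B I y b)"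

text \<open>
  Expected revenue of the seller conditional on the signals \<open>(y1, y2)\<close>: the buyer with the higher
  bid wins and pays the security bid of the other one.  (Equal bids are resolved in favour of
  buyer 2; for strictly increasing bids and distinct signals this does not occur.)
\<close>

definition seller_revenue ::
  "(real \<Rightarrow> real \<Rightarrow> real) \<Rightarrow> (real \<Rightarrow> real \<Rightarrow> real) \<Rightarrow> real set \<Rightarrow> real \<Rightarrow> real \<Rightarrow> real \<Rightarrow> real"
where
  "seller_revenue f \<phi> B I y1 y2 =
     (let b1 = equilibrium_bid f \<phi> B I y1; b2 = equilibrium_bid f \<phi> B I y2
      in cond_expect (pair_pdf f)
           (\<lambda>(x1, x2). \<phi> (if b1 > b2 then x1 else x2) (min b1 b2)) (y1, y2))"

definition value_pdf :: "real \<Rightarrow> real \<Rightarrow> real" where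
  "value_pdf y x =
     (if 0 \<le> x \<and> x \<le> 1/3 then 1 - y + 6 * x * y else if 1/3 < x \<and> x \<le> 1 then 1 else 0)"

lemma cond_pdf_pair:
  fixes X1 X2 Y1 Y2 :: "'a \<Rightarrow> real"
  assumes "prob_space M"
    and iv: "prob_space.indep_var M borel (\<lambda>\<omega>. (X1 \<omega>, Y1 \<omega>)) borel (\<lambda>\<omega>. (X2 \<omega>, Y2 \<omega>))"
    and c1: "cond_pdf M X1 Y1 f" and c2: "cond_pdf M X2 Y2 f"
  shows "cond_pdf M (\<lambda>\<omega>. (X1 \<omega>, X2 \<omega>)) (\<lambda>\<omega>. (Y1 \<omega>, Y2 \<omega>)) (pair_pdf f)"
proof -
  interpret prob_space M by fact
  have X1[measurable]: "X1 \<in> borel_measurable M" and X2[measurable]: "X2 \<in> borel_measurable M"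
    and Y1[measurable]: "Y1 \<in> borel_measurable M" and Y2[measurable]: "Y2 \<in> borel_measurable M"
    using c1 c2 by (simp_all add: cond_pdf_def)
  define P1 where "P1 = distr M borel Y1"
  define P2 where "P2 = distr M borel Y2"
  have sP[measurable_cong]: "sets P1 = sets borel" "sets P2 = sets borel"
    by (simp_all add: P1_def P2_def)
  interpret P1: prob_space P1 unfolding P1_def by (rule prob_space_distr) simp
  interpret P2: prob_space P2 unfolding P2_def by (rule prob_space_distr) simp
  have "case_prod f \<in> borel_measurable borel" using c1 by (simp add: cond_pdf_def)
  hence f: "case_prod f \<in> borel_measurable (borel \<Otimes>\<^sub>M borel)"
    by (simp add: borel_prod)
  have f' [measurable]: "(\<lambda>x. f (g x) (h x)) \<in> borel_measurable N"
    if [measurable]: "g \<in> borel_measurable N" "h \<in> borel_measurable N" for g h and N :: "'n measure"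
    using measurable_compose[OF measurable_Pair[OF that] f] by simp
  have swap: "prod.swap \<in> borel_measurable (borel :: (real \<times> real) measure)"
    by (intro borel_measurable_continuous_onI continuous_on_swap)
  have snd: "snd \<in> borel_measurable (borel :: (real \<times> real) measure)"
    by (intro borel_measurable_continuous_onI continuous_on_snd continuous_on_id)
  have iv2: "indep_var borel (\<lambda>\<omega>. (Y1 \<omega>, X1 \<omega>)) borel (\<lambda>\<omega>. (Y2 \<omega>, X2 \<omega>))"
    using indep_var_compose[OF iv swap swap] by (simp add: comp_def)
  have iv3: "indep_var borel Y1 borel Y2"
    using indep_var_compose[OF iv snd snd] by (simp add: comp_def)
  have PY: "distr M borel (\<lambda>\<omega>. (Y1 \<omega>, Y2 \<omega>)) = P1 \<Otimes>\<^sub>M P2"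
    using iv3 unfolding indep_var_distribution_eq by (simp add: P1_def P2_def borel_prod)
  let ?f = "\<lambda>(y, x). ennreal (f y x)"
  have D1: "distr M borel (\<lambda>\<omega>. (Y1 \<omega>, X1 \<omega>)) = density (P1 \<Otimes>\<^sub>M lborel) ?f"
    using c1 by (simp add: cond_pdf_def P1_def)
  have D2: "distr M borel (\<lambda>\<omega>. (Y2 \<omega>, X2 \<omega>)) = density (P2 \<Otimes>\<^sub>M lborel) ?f"
    using c2 by (simp add: cond_pdf_def P2_def)
  let ?J = "distr M ((borel \<Otimes>\<^sub>M borel) \<Otimes>\<^sub>M (borel \<Otimes>\<^sub>M borel)) (\<lambda>\<omega>. ((Y1 \<omega>, X1 \<omega>), (Y2 \<omega>, X2 \<omega>)))"
  let ?D1 = "density (P1 \<Otimes>\<^sub>M lborel) ?f" and ?D2 = "density (P2 \<Otimes>\<^sub>M lborel) ?f"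
  have J: "?J = ?D1 \<Otimes>\<^sub>M ?D2"
    using iv2 unfolding indep_var_distribution_eq by (simp only: D1 D2 borel_prod)
  interpret D2: prob_space ?D2
    unfolding D2[symmetric] by (rule prob_space_distr) (simp flip: borel_prod)
  interpret L: pair_sigma_finite P2 "lborel :: real measure" ..
  interpret L1: pair_sigma_finite P1 "lborel :: real measure" ..
  have LL: "sigma_finite_measure (lborel \<Otimes>\<^sub>M lborel :: (real \<times> real) measure)"
    unfolding lborel_prod by (rule sigma_finite_lborel)
  interpret P12: pair_sigma_finite P1 P2 ..
  interpret LP: pair_sigma_finite "lborel :: real measure" P2 ..
  have n1: "AE y in P1. \<forall>x. 0 \<le> f y x" and n2: "AE y in P2. \<forall>x. 0 \<le> f y x"
    using c1 c2 unfolding cond_pdf_def P1_def P2_def by blast+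
  interpret PP: prob_space "P1 \<Otimes>\<^sub>M P2"
    unfolding PY[symmetric] by (rule prob_space_distr) (simp flip: borel_prod)

  have n: "AE z in P1 \<Otimes>\<^sub>M P2. \<forall>x. 0 \<le> pair_pdf f z x"
  proof -
    have "AE z in P1 \<Otimes>\<^sub>M P2. \<forall>x. 0 \<le> f (fst z) x"
    proof -
      obtain N where N: "{y \<in> space P1. \<not> (\<forall>x. 0 \<le> f y x)} \<subseteq> N" "emeasure P1 N = 0" "N \<in> sets P1"
        using n1 by (rule AE_E)
      show ?thesis
        by (rule AE_I[where N = "N \<times> space P2"])
          (use N in \<open>fastforce simp: space_pair_measure P2.emeasure_pair_measure_Times\<close>)+
    qed
    moreover have "AE z in P1 \<Otimes>\<^sub>M P2. \<forall>x. 0 \<le> f (snd z) x"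
    proof -
      obtain N where N: "{y \<in> space P2. \<not> (\<forall>x. 0 \<le> f y x)} \<subseteq> N" "emeasure P2 N = 0" "N \<in> sets P2"
        using n2 by (rule AE_E)
      show ?thesis
        by (rule AE_I[where N = "space P1 \<times> N"])
          (use N in \<open>fastforce simp: space_pair_measure P2.emeasure_pair_measure_Times\<close>)+
    qed
    ultimately show ?thesis
      by eventually_elim (simp add: pair_pdf_def split_beta)
  qed
  have eq: "distr M borel (\<lambda>\<omega>. ((Y1 \<omega>, Y2 \<omega>), (X1 \<omega>, X2 \<omega>))) =
      density ((P1 \<Otimes>\<^sub>M P2) \<Otimes>\<^sub>M lborel) (\<lambda>(y, x). ennreal (pair_pdf f y x))"
  proof (rule measure_eqI)
    show "sets (distr M borel (\<lambda>\<omega>. ((Y1 \<omega>, Y2 \<omega>), (X1 \<omega>, X2 \<omega>)))) =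
        sets (density ((P1 \<Otimes>\<^sub>M P2) \<Otimes>\<^sub>M lborel) (\<lambda>(y, x). ennreal (pair_pdf f y x)))"
      by (auto simp: sP simp flip: borel_prod intro!: sets_pair_measure_cong)
  next
    fix A assume "A \<in> sets (distr M borel (\<lambda>\<omega>. ((Y1 \<omega>, Y2 \<omega>), (X1 \<omega>, X2 \<omega>))))"
    hence A[measurable]: "A \<in> sets ((borel \<Otimes>\<^sub>M borel) \<Otimes>\<^sub>M (borel \<Otimes>\<^sub>M borel))"
      unfolding borel_prod by simp
    have m: "(\<lambda>\<omega>. ((Y1 \<omega>, Y2 \<omega>), (X1 \<omega>, X2 \<omega>))) \<in> M \<rightarrow>\<^sub>M (borel \<Otimes>\<^sub>M borel) \<Otimes>\<^sub>M (borel \<Otimes>\<^sub>M borel)"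
      by simp
    have Ax[measurable]: "(\<lambda>x. indicator A (y, x) :: ennreal) \<in> borel_measurable (lborel \<Otimes>\<^sub>M lborel)" for y
    proof -
      have "Pair y \<in> lborel \<Otimes>\<^sub>M lborel \<rightarrow>\<^sub>M (borel \<Otimes>\<^sub>M borel) \<Otimes>\<^sub>M (borel \<Otimes>\<^sub>M borel)"
        by (rule measurable_Pair) (auto simp: space_pair_measure)
      then show ?thesis by (rule measurable_compose) (rule borel_measurable_indicator[OF A])
    qed
    let ?i = "\<lambda>y1 x1 y2 x2. indicator A ((y1, y2), (x1, x2)) :: ennreal"
    have "emeasure (distr M borel (\<lambda>\<omega>. ((Y1 \<omega>, Y2 \<omega>), (X1 \<omega>, X2 \<omega>)))) A =
        (\<integral>\<^sup>+ \<omega>. ?i (Y1 \<omega>) (X1 \<omega>) (Y2 \<omega>) (X2 \<omega>) \<partial>M)"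
      proof -
      let ?D = "distr M ((borel \<Otimes>\<^sub>M borel) \<Otimes>\<^sub>M (borel \<Otimes>\<^sub>M borel)) (\<lambda>\<omega>. ((Y1 \<omega>, Y2 \<omega>), (X1 \<omega>, X2 \<omega>)))"
      have "emeasure ?D A = (\<integral>\<^sup>+ z. indicator A z \<partial>?D)"
        by (rule nn_integral_indicator[symmetric]) (simp add: A)
      also have "\<dots> = (\<integral>\<^sup>+ \<omega>. ?i (Y1 \<omega>) (X1 \<omega>) (Y2 \<omega>) (X2 \<omega>) \<partial>M)"
        by (rule nn_integral_distr[OF m]) simp
      finally show ?thesis by (simp only: borel_prod)
    qed
    also have "\<dots> = (\<integral>\<^sup>+ z. ?i (fst (fst z)) (snd (fst z)) (fst (snd z)) (snd (snd z)) \<partial>?J)"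
      by (subst nn_integral_distr) simp_all
    also have "\<dots> = (\<integral>\<^sup>+ z1. \<integral>\<^sup>+ z2. ?i (fst z1) (snd z1) (fst z2) (snd z2) \<partial>?D2 \<partial>?D1)"
      unfolding J by (subst D2.nn_integral_fst[symmetric]) (simp_all add: split_beta)
    also have "\<dots> = (\<integral>\<^sup>+ z1. \<integral>\<^sup>+ z2. ?f z1 * (?f z2 * ?i (fst z1) (snd z1) (fst z2) (snd z2)) \<partial>(P2 \<Otimes>\<^sub>M lborel) \<partial>(P1 \<Otimes>\<^sub>M lborel))"
      by (simp add: nn_integral_density split_beta nn_integral_cmult)
    also have "\<dots> = (\<integral>\<^sup>+ y1. \<integral>\<^sup>+ x1. \<integral>\<^sup>+ y2. \<integral>\<^sup>+ x2. f y1 x1 * (f y2 x2 * ?i y1 x1 y2 x2)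
        \<partial>lborel \<partial>P2 \<partial>lborel \<partial>P1)"
      by (subst lborel.nn_integral_fst[symmetric], simp, subst lborel.nn_integral_fst[symmetric], simp, simp)
    also have "\<dots> = (\<integral>\<^sup>+ y1. \<integral>\<^sup>+ y2. \<integral>\<^sup>+ x1. \<integral>\<^sup>+ x2. f y1 x1 * (f y2 x2 * ?i y1 x1 y2 x2)
        \<partial>lborel \<partial>lborel \<partial>P2 \<partial>P1)"
      by (subst LP.Fubini') simp_all
    also have "\<dots> = (\<integral>\<^sup>+ y1. \<integral>\<^sup>+ y2. \<integral>\<^sup>+ x1. \<integral>\<^sup>+ x2. ennreal (pair_pdf f (y1, y2) (x1, x2)) * ?i y1 x1 y2 x2
        \<partial>lborel \<partial>lborel \<partial>P2 \<partial>P1)"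
      using n1
    proof (intro nn_integral_cong_AE, eventually_elim)
      fix y1 assume y1: "\<forall>x. 0 \<le> f y1 x"
      show "(\<integral>\<^sup>+ y2. \<integral>\<^sup>+ x1. \<integral>\<^sup>+ x2. f y1 x1 * (f y2 x2 * ?i y1 x1 y2 x2) \<partial>lborel \<partial>lborel \<partial>P2) =
        (\<integral>\<^sup>+ y2. \<integral>\<^sup>+ x1. \<integral>\<^sup>+ x2. ennreal (pair_pdf f (y1, y2) (x1, x2)) * ?i y1 x1 y2 x2
          \<partial>lborel \<partial>lborel \<partial>P2)"
        using n2 by (intro nn_integral_cong_AE, eventually_elim)
          (use y1 in \<open>simp add: pair_pdf_def ennreal_mult mult.assoc\<close>)
    qed
    also have "\<dots> = (\<integral>\<^sup>+ y. \<integral>\<^sup>+ x1. \<integral>\<^sup>+ x2. ennreal (pair_pdf f y (x1, x2)) * indicator A (y, (x1, x2))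
        \<partial>lborel \<partial>lborel \<partial>(P1 \<Otimes>\<^sub>M P2))"
      by (subst P2.nn_integral_fst[symmetric]) (simp_all add: pair_pdf_def split_beta)
    also have "\<dots> = (\<integral>\<^sup>+ y. \<integral>\<^sup>+ x. ennreal (pair_pdf f y x) * indicator A (y, x) \<partial>lborel \<partial>(P1 \<Otimes>\<^sub>M P2))"
      by (intro nn_integral_cong, unfold lborel_prod[symmetric], subst lborel.nn_integral_fst[symmetric])
        (simp_all add: pair_pdf_def split_beta)
    also have "\<dots> = emeasure (density ((P1 \<Otimes>\<^sub>M P2) \<Otimes>\<^sub>M lborel) (\<lambda>(y, x). ennreal (pair_pdf f y x))) A"
      unfolding lborel_prod[symmetric]
      by (subst emeasure_density, simp_all add: pair_pdf_def split_beta)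
        (subst sigma_finite_measure.nn_integral_fst[OF LL, symmetric], simp_all)
    finally show "emeasure (distr M borel (\<lambda>\<omega>. ((Y1 \<omega>, Y2 \<omega>), (X1 \<omega>, X2 \<omega>)))) A =
      emeasure (density ((P1 \<Otimes>\<^sub>M P2) \<Otimes>\<^sub>M lborel) (\<lambda>(y, x). ennreal (pair_pdf f y x))) A" .
  qed
  have m: "case_prod (pair_pdf f) \<in> borel_measurable borel"
    unfolding pair_pdf_def borel_prod[symmetric] case_prod_unfold by simp
  show ?thesis
    unfolding cond_pdf_def PY using n eq m by (auto simp flip: borel_prod)
qed

lemma value_pdf_is_pdf:
  assumes "y \<in> {0..1}"
  shows "0 \<le> value_pdf y x" and "(value_pdf y has_integral 1) UNIV"
proof -
  have "0 \<le> y * x" if "0 \<le> x" using that assms by simp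
  thus "0 \<le> value_pdf y x"
    using assms by (auto simp: value_pdf_def mult_ac intro!: add_nonneg_nonneg)
  let ?F = "\<lambda>x. (1 - y) * x + 3 * y * x^2"
  have "((\<lambda>x. 1 - y + 6 * x * y) has_integral (?F (1/3) - ?F 0)) {0..1/3}"
    by (rule fundamental_theorem_of_calculus)
      (auto intro!: derivative_eq_intros simp flip: has_real_derivative_iff_has_vector_derivative)
  hence 1: "(value_pdf y has_integral (?F (1/3) - ?F 0)) {0..1/3}"
    by (rule has_integral_eq[rotated]) (simp add: value_pdf_def)
  have "((\<lambda>x. 1) has_integral (2/3::real)) {1/3..1::real}"
    using has_integral_const_real[of "1::real" "1/3" 1] by simp
  hence 2: "(value_pdf y has_integral 2/3) {1/3..1}"
    by (rule has_integral_spike[of "{1/3}", rotated 2]) (auto simp: value_pdf_def)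
  have "(value_pdf y has_integral (?F (1/3) - ?F 0 + 2/3)) {0..1}"
    by (rule has_integral_combine[OF _ _ 1 2]) auto
  hence "(value_pdf y has_integral 1) {0..1}"
    by (simp add: field_simps power2_eq_square)
  thus "(value_pdf y has_integral 1) UNIV"
    by (rule has_integral_on_superset) (auto simp: value_pdf_def)
qed

end

theory Submission
  imports Defs
begin

text \<open>
  With \<open>t = max 0 (1/3 - b)\<close> and \<open>s b = t\<^sup>2/2 - t\<^sup>3\<close> one has \<open>\<bbbE>[X | Y = y] = 1/2 + y/54 =: m y\<close> and
  \<open>\<bbbE>[(X - b)\<^sup>+ | Y = y] = (1 - b)\<^sup>2/2 + y s b\<close>.  Hence the debt bid solves
  \<open>(1 - b)\<^sup>2/2 + y s b = I\<close>, the equity bid is \<open>1 - I / m y\<close>, and the debt revenue exceeds the equity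
  revenue by \<open>(y\<^sub>i - y\<^sub>j) (I / (54 m y\<^sub>j) - s b)\<close>, where \<open>b\<close> is the debt bid at \<open>y\<^sub>j\<close>.
  For \<open>I > 2/9\<close> the debt bids stay below \<open>1/3\<close>, where \<open>s > 0\<close> makes them strictly increasing in
  the signal; for \<open>I\<close> close enough to \<open>2/9\<close> they stay so close to \<open>1/3\<close> that \<open>s b\<close> is below
  \<open>1/126 \<le> I / (54 m y\<^sub>j)\<close>.  The interval \<open>1/4 \<le> I \<le> 3/10\<close> satisfies both requirements.
\<close>

section \<open>Expectations under \<open>value_pdf\<close>\<close>

text \<open>For \<open>y\<close> other than 0 the density jumps at 1/3, so the integrand is split
  into two continuous pieces; the second interval is half-open to keep them disjoint. Linearity,
  Fubini and the passage to gauge integrals all rest on this.\<close>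

lemma integrable_mult_value_pdf:
  assumes g: "continuous_on UNIV g"
  shows "integrable lborel (\<lambda>x. g x * value_pdf y x)"
proof -
  have c: "continuous_on A g" for A
    using g by (rule continuous_on_subset) simp
  have 1: "set_integrable lborel {0..1/3} (\<lambda>x. g x * (1 - y + 6 * x * y))"
    by (intro borel_integrable_atLeastAtMost' continuous_intros c)
  have 2: "set_integrable lborel {1/3<..1} g"
    by (rule set_integrable_subset[OF borel_integrable_atLeastAtMost'[of "1/3" 1, OF c]]) auto
  have "integrable lborel (\<lambda>x. indicator {0..1/3} x *\<^sub>R (g x * (1 - y + 6 * x * y))
      + indicator {1/3<..1} x *\<^sub>R g x)"
    using 1 2 unfolding set_integrable_def by (rule Bochner_Integration.integrable_add)
  also have "(\<lambda>x. indicator {0..1/3} x *\<^sub>R (g x * (1 - y + 6 * x * y))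
      + indicator {1/3<..1} x *\<^sub>R g x) = (\<lambda>x. g x * value_pdf y x)"
    by (auto simp: value_pdf_def indicator_def)
  finally show ?thesis .
qed

text \<open>Turns the Lebesgue expectation into two gauge integrals that the fundamental theorem of
  calculus can evaluate.\<close>

lemma cond_expect_value_pdf_eq:
  assumes g: "continuous_on UNIV g"
    and A: "((\<lambda>x. g x * (1 - y + 6 * x * y)) has_integral A) {0..1/3}"
    and B: "(g has_integral B) {1/3..1}"
  shows "cond_expect value_pdf g y = A + B"
proof -
  let ?h = "\<lambda>x. g x * value_pdf y x"
  have "(?h has_integral A) {0..1/3}"
    by (rule has_integral_eq[OF _ A]) (simp add: value_pdf_def)
  \<comment> \<open>At 1/3 itself \<open>value_pdf\<close> takes its left branch, hence the
    exceptional point.\<close>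
  moreover have "(?h has_integral B) {1/3..1}"
    by (rule has_integral_spike[of "{1/3}", OF _ _ B]) (auto simp: value_pdf_def)
  ultimately have "(?h has_integral (A + B)) {0..1}"
    by (intro has_integral_combine[of 0 "1/3" 1]) auto
  hence "(?h has_integral (A + B)) UNIV"
    by (rule has_integral_on_superset) (auto simp: value_pdf_def)
  moreover have "(?h has_integral cond_expect value_pdf g y) UNIV"
    unfolding cond_expect_def
    by (rule has_integral_integral_lborel) (rule integrable_mult_value_pdf[OF g])
  ultimately show ?thesis by (rule has_integral_unique[symmetric])
qed

lemma cond_expect_value_pdf_diff:
  assumes "continuous_on UNIV g" "continuous_on UNIV h"
  shows "cond_expect value_pdf (\<lambda>x. g x - h x) y
    = cond_expect value_pdf g y - cond_expect value_pdf h y"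
  unfolding cond_expect_def left_diff_distrib
  by (intro Bochner_Integration.integral_diff integrable_mult_value_pdf assms)

lemma cond_expect_cmult:
  "cond_expect f (\<lambda>x. c * g x) y = c * cond_expect f g y"
  unfolding cond_expect_def mult.assoc by simp

text \<open>The mass of [0, 1/3] is (1 - y)/3 + y/3 = 1/3 for every \<open>y\<close>: the signal
  only redistributes mass inside that interval.\<close>

lemma cond_expect_value_pdf_const:
  "cond_expect value_pdf (\<lambda>x. c) y = c"
proof -
  let ?F = "\<lambda>x. c * ((1 - y) * x + 3 * y * x^2)"
  have 1: "((\<lambda>x. c * (1 - y + 6 * x * y)) has_integral (?F (1/3) - ?F 0)) {0..1/3}"
    by (rule fundamental_theorem_of_calculus)
      (auto intro!: derivative_eq_intros simp flip: has_real_derivative_iff_has_vector_derivative)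
  have 2: "((\<lambda>x. c) has_integral (2/3 * c)) {1/3..1::real}"
    using has_integral_const_real[of c "1/3" 1] by simp
  show ?thesis
    unfolding cond_expect_value_pdf_eq[OF continuous_on_const 1 2]
    by (simp add: power2_eq_square field_simps)
qed

lemma cond_expect_value_pdf_id:
  "cond_expect value_pdf (\<lambda>x. x) y = 1/2 + y/54"
proof -
  let ?F = "\<lambda>x. (1 - y) * x^2 / 2 + 2 * y * x^3"
  have 1: "((\<lambda>x. x * (1 - y + 6 * x * y)) has_integral (?F (1/3) - ?F 0)) {0..1/3}"
    by (rule fundamental_theorem_of_calculus)
      (auto intro!: derivative_eq_intros simp: algebra_simps diff_divide_distrib power2_eq_square
        simp flip: has_real_derivative_iff_has_vector_derivative)
  have 2: "((\<lambda>x. x) has_integral (1^2/2 - (1/3)^2/2)) {1/3..1::real}"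
    by (rule fundamental_theorem_of_calculus)
      (auto intro!: derivative_eq_intros simp flip: has_real_derivative_iff_has_vector_derivative)
  show ?thesis
    unfolding cond_expect_value_pdf_eq[OF continuous_on_id 1 2]
    by (simp add: power2_eq_square power3_eq_cube field_simps)
qed

section \<open>Expected payments under debt and equity\<close>

lemma continuous_on_debt: "continuous_on S (\<lambda>x. debt x b)"
  unfolding debt_def by (intro continuous_intros)

lemma continuous_on_equity: "continuous_on S (\<lambda>x. equity x b)"
  unfolding equity_def by (intro continuous_intros)

text \<open>The coefficient of the signal \<open>y\<close> in \<open>\<bbbE>[(X - b)\<^sup>+ | Y = y]\<close>.\<close>

definition call_slope :: "real \<Rightarrow> real" where
  "call_slope b = (max 0 (1/3 - b))^2 / 2 - (max 0 (1/3 - b))^3"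

lemma call_slope_eq_0: "1/3 \<le> b \<Longrightarrow> call_slope b = 0"
  by (simp add: call_slope_def)

text \<open>Since min(x, b) = x - (x - b)^+, this is the mean minus a call value: (1 - b)^2/2 from
  the uniform density, plus \<open>y\<close> times the integral of (x - b)(6x - 1) over [b, 1/3].
  The cases depend on which side of the density's jump at 1/3 the kink of the debt lies.\<close>

lemma cond_expect_debt:
  assumes b: "b \<in> {0..1}"
  shows "cond_expect value_pdf (\<lambda>x. debt x b) y
    = 1/2 + y/54 - ((1 - b)^2 / 2 + y * call_slope b)"
proof (cases "b \<le> 1/3")
  case True
  let ?F = "\<lambda>x. (1 - y) * x^2 / 2 + 2 * y * x^3" and ?G = "\<lambda>x. b * ((1 - y) * x + 3 * y * x^2)"
  have "((\<lambda>x. x * (1 - y + 6 * x * y)) has_integral (?F b - ?F 0)) {0..b}"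
    by (rule fundamental_theorem_of_calculus)
      (use b in \<open>auto intro!: derivative_eq_intros simp: algebra_simps diff_divide_distrib power2_eq_square
        simp flip: has_real_derivative_iff_has_vector_derivative\<close>)
  hence 1: "((\<lambda>x. debt x b * (1 - y + 6 * x * y)) has_integral (?F b - ?F 0)) {0..b}"
    by (rule has_integral_eq[rotated]) (simp add: debt_def)
  have "((\<lambda>x. b * (1 - y + 6 * x * y)) has_integral (?G (1/3) - ?G b)) {b..1/3}"
    by (rule fundamental_theorem_of_calculus)
      (use True in \<open>auto intro!: derivative_eq_intros
        simp flip: has_real_derivative_iff_has_vector_derivative\<close>)
  hence 2: "((\<lambda>x. debt x b * (1 - y + 6 * x * y)) has_integral (?G (1/3) - ?G b)) {b..1/3}"
    by (rule has_integral_eq[rotated]) (simp add: debt_def)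
  have 3: "((\<lambda>x. debt x b * (1 - y + 6 * x * y)) has_integral
      (?F b - ?F 0 + (?G (1/3) - ?G b))) {0..1/3}"
    by (rule has_integral_combine[OF _ _ 1 2]) (use b True in auto)
  have "((\<lambda>x. b) has_integral (2/3 * b)) {1/3..1::real}"
    using has_integral_const_real[of b "1/3" 1] by simp
  hence 4: "((\<lambda>x. debt x b) has_integral (2/3 * b)) {1/3..1}"
    by (rule has_integral_eq[rotated]) (use True in \<open>simp add: debt_def\<close>)
  have s: "call_slope b = (1/3 - b)^2/2 - (1/3 - b)^3"
    using True by (simp add: call_slope_def max_def)
  show ?thesis
    unfolding cond_expect_value_pdf_eq[OF continuous_on_debt 3 4] s
    by (simp add: power2_eq_square power3_eq_cube field_simps)
next
  case False
  let ?F = "\<lambda>x. (1 - y) * x^2 / 2 + 2 * y * x^3"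
  have "((\<lambda>x. x * (1 - y + 6 * x * y)) has_integral (?F (1/3) - ?F 0)) {0..1/3}"
    by (rule fundamental_theorem_of_calculus)
      (auto intro!: derivative_eq_intros simp: algebra_simps diff_divide_distrib power2_eq_square
        simp flip: has_real_derivative_iff_has_vector_derivative)
  hence 1: "((\<lambda>x. debt x b * (1 - y + 6 * x * y)) has_integral (?F (1/3) - ?F 0)) {0..1/3}"
    by (rule has_integral_eq[rotated]) (use False in \<open>simp add: debt_def\<close>)
  have "((\<lambda>x. x) has_integral (b^2/2 - (1/3)^2/2)) {1/3..b}"
    by (rule fundamental_theorem_of_calculus)
      (use False in \<open>auto intro!: derivative_eq_intros
        simp flip: has_real_derivative_iff_has_vector_derivative\<close>)
  hence 2: "((\<lambda>x. debt x b) has_integral (b^2/2 - (1/3)^2/2)) {1/3..b}"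
    by (rule has_integral_eq[rotated]) (simp add: debt_def)
  have "((\<lambda>x. b) has_integral ((1 - b) * b)) {b..1}"
    using has_integral_const_real[of b b 1] b by simp
  hence 3: "((\<lambda>x. debt x b) has_integral ((1 - b) * b)) {b..1}"
    by (rule has_integral_eq[rotated]) (simp add: debt_def)
  have 4: "((\<lambda>x. debt x b) has_integral (b^2/2 - (1/3)^2/2 + (1 - b) * b)) {1/3..1}"
    by (rule has_integral_combine[OF _ _ 2 3]) (use b False in auto)
  have s: "call_slope b = 0"
    using False by (simp add: call_slope_eq_0)
  show ?thesis
    unfolding cond_expect_value_pdf_eq[OF continuous_on_debt 1 4] s
    by (simp add: power2_eq_square power3_eq_cube field_simps)
qed

lemma cond_expect_equity:
  "cond_expect value_pdf (\<lambda>x. equity x b) y = b * (1/2 + y/54)"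
  unfolding equity_def cond_expect_cmult cond_expect_value_pdf_id ..

section \<open>Zero-profit bids\<close>

lemma zero_profit_bid_value_pdf_iff:
  assumes "continuous_on UNIV (\<lambda>x. \<phi> x b)"
  shows "zero_profit_bid value_pdf \<phi> B I y b \<longleftrightarrow>
    b \<in> B \<and> cond_expect value_pdf (\<lambda>x. \<phi> x b) y = 1/2 + y/54 - I"
proof -
  have "cond_expect value_pdf (\<lambda>x. x - I - \<phi> x b) y
      = 1/2 + y/54 - I - cond_expect value_pdf (\<lambda>x. \<phi> x b) y"
    using assms by (simp add: cond_expect_value_pdf_diff cond_expect_value_pdf_id
      cond_expect_value_pdf_const continuous_on_diff)
  thus ?thesis by (auto simp: zero_profit_bid_def)
qed

text \<open>The mean cancels: a buyer who owes debt \<open>b\<close> holds a call on the value with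
  strike \<open>b\<close>, and its worth must cover \<open>I\<close>.\<close>

lemma zero_profit_bid_debt_iff:
  "zero_profit_bid value_pdf debt debt_bids I y b \<longleftrightarrow>
    b \<in> {0..1} \<and> (1 - b)^2 / 2 + y * call_slope b = I"
  unfolding zero_profit_bid_value_pdf_iff[of debt, OF continuous_on_debt]
  by (auto simp: debt_bids_def cond_expect_debt)

text \<open>The equation is linear in \<open>b\<close>. The bound on \<open>\<delta>\<close> keeps
  its root below \<open>1 - \<delta>\<close>, and \<open>I \<le> 1/2\<close> keeps it
  nonnegative.\<close>

lemma zero_profit_bid_equity_iff:
  assumes "0 \<le> y" and "0 \<le> I" and "I \<le> 1/2" and "\<delta> * (1/2 + y/54) \<le> I"
  shows "zero_profit_bid value_pdf equity (equity_bids \<delta>) I y b \<longleftrightarrow> b = 1 - I / (1/2 + y/54)"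
proof -
  have m: "1/2 + y/54 > 0" using assms by simp
  have "\<delta> \<le> I / (1/2 + y/54)" "I / (1/2 + y/54) \<le> 1"
    using m assms by (simp_all add: pos_le_divide_eq pos_divide_le_eq)
  hence "1 - I / (1/2 + y/54) \<in> equity_bids \<delta>" by (simp add: equity_bids_def)
  moreover have "b * (1/2 + y/54) = 1/2 + y/54 - I \<longleftrightarrow> b = 1 - I / (1/2 + y/54)"
    using m by (auto simp: field_simps)
  ultimately show ?thesis
    unfolding zero_profit_bid_value_pdf_iff[of equity, OF continuous_on_equity] cond_expect_equity
    by blast
qed

section \<open>Monotonicity of the call value and bounds on the debt bid\<close>

text \<open>The cubic t^2/2 - t^3 increases on [0, 1/3]; \<open>0 \<le> a\<close> keeps t in that
  range.\<close>

lemma call_slope_antimono: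
  assumes "0 \<le> a" "a \<le> b"
  shows "call_slope b \<le> call_slope a"
proof -
  define s t where "s = max 0 (1/3 - b)" and "t = max 0 (1/3 - a)"
  have st: "0 \<le> s" "s \<le> t" "t \<le> 1/3" using assms by (auto simp: s_def t_def max_def)
  \<comment> \<open>Averaging the two bounds on the mixed product gives st <= (s + t)/6, so that t^2
    + st + s^2 <= (s + t)/2.\<close>
  have "s * s \<le> 1/3 * s" "t * t \<le> 1/3 * t" "t * s \<le> 1/3 * s" "s * t \<le> 1/3 * t"
    using st by (intro mult_right_mono; linarith)+
  hence "0 \<le> (t + s) / 2 - (t * t + s * t + s * s)"
    unfolding mult.commute[of t s] by argo
  hence "0 \<le> (t - s) * ((t + s) / 2 - (t * t + s * t + s * s))"
    using st by (intro mult_nonneg_nonneg) auto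
  also have "\<dots> = call_slope a - call_slope b"
    unfolding call_slope_def s_def[symmetric] t_def[symmetric]
    by (simp add: power2_eq_square power3_eq_cube field_simps)
  finally show ?thesis by simp
qed

lemma call_slope_nonneg:
  assumes "0 \<le> b"
  shows "0 \<le> call_slope b"
  using call_slope_antimono[of b "max b (1/3)"] assms by (simp add: call_slope_def)

lemma call_slope_pos:
  assumes "0 \<le> b" "b < 1/3"
  shows "0 < call_slope b"
proof -
  define t where "t = 1/3 - b"
  have t: "0 < t" "t < 1/2" using assms by (auto simp: t_def)
  hence "0 < t^2 * (1/2 - t)" by simp
  also have "\<dots> = call_slope b"
    unfolding call_slope_def t_def[symmetric] max_absorb2[OF less_imp_le[OF t(1)]]
    by (simp add: power2_eq_square power3_eq_cube field_simps)
  finally show ?thesis .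
qed

text \<open>At 5/24 one has t = 1/8 and slope 3/512. The bound 1/126 = (2/9)/28 is I/(54 m) for the
  limiting investment 2/9 and the largest mean m = 28/54.\<close>

lemma call_slope_less:
  assumes "5/24 \<le> b"
  shows "call_slope b < 1/126"
proof -
  have "call_slope b \<le> call_slope (5/24)"
    using assms by (intro call_slope_antimono) auto
  also have "\<dots> < 1/126" by (simp add: call_slope_def max_def power2_eq_square power3_eq_cube)
  finally show ?thesis .
qed

text \<open>Strictness comes from the quadratic term alone, so it persists for \<open>y = 0\<close>
  and beyond 1/3, where \<open>call_slope\<close> is constant.\<close>

lemma call_value_strict_antimono:
  assumes "0 \<le> y" "0 \<le> a" "a < b" "b \<le> 1"
  shows "(1 - b)^2 / 2 + y * call_slope b < (1 - a)^2 / 2 + y * call_slope a"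
proof -
  have "(1 - b)^2 < (1 - a)^2" using assms by (intro power_strict_mono) auto
  moreover have "y * call_slope b \<le> y * call_slope a"
    using assms by (intro mult_left_mono call_slope_antimono) auto
  ultimately show ?thesis by simp
qed

text \<open>The call value is at least 1/2 at strike 0 and vanishes at strike 1: the intermediate
  value theorem gives a solution, strict monotonicity its uniqueness.\<close>

lemma ex1_zero_profit_bid_debt:
  assumes y: "0 \<le> y" and I: "0 \<le> I" "I \<le> 1/2"
  shows "\<exists>!b. zero_profit_bid value_pdf debt debt_bids I y b"
proof -
  let ?K = "\<lambda>b. (1 - b)^2 / 2 + y * call_slope b"
  have c: "continuous_on {0..1} ?K"
    unfolding call_slope_def by (intro continuous_intros) auto
  have "?K 1 \<le> I" "I \<le> ?K 0"
    using y I call_slope_nonneg[of 0] by (auto simp: call_slope_def power2_eq_square power3_eq_cube)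
  then obtain b where "0 \<le> b" "b \<le> 1" "?K b = I"
    using IVT2'[of ?K 1 I 0, OF _ _ _ c] by auto
  moreover have "a = b" if "a \<in> {0..1}" "b \<in> {0..1}" "?K a = ?K b" for a b
    using that call_value_strict_antimono[OF y, of a b] call_value_strict_antimono[OF y, of b a]
    by (cases a b rule: linorder_cases) auto
  ultimately show ?thesis
    unfolding zero_profit_bid_debt_iff by (intro ex1I[of _ b]) auto
qed

text \<open>A strike of at least 1/3 makes the call worth at most 2/9 < 1/4; a strike below 5/24
  makes it worth at least (19/24)^2/2 > 3/10.\<close>

lemma debt_bid_bounds:
  assumes "0 \<le> y" and "0 \<le> b" "b \<le> 1" and eq: "(1 - b)^2 / 2 + y * call_slope b = I"
    and I: "1/4 \<le> I" "I \<le> 3/10"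
  shows "5/24 \<le> b" and "b < 1/3"
proof -
  show "b < 1/3"
  proof (rule ccontr)
    assume "\<not> b < 1/3"
    hence "call_slope b = 0" by (intro call_slope_eq_0) simp
    moreover have "(1 - b)^2 \<le> (2/3)^2"
      using assms \<open>\<not> b < 1/3\<close> by (intro power_mono) auto
    ultimately show False using eq I by (simp add: power2_eq_square)
  qed
  show "5/24 \<le> b"
  proof (rule ccontr)
    assume "\<not> 5/24 \<le> b"
    hence "(19/24)^2 \<le> (1 - b)^2" by (intro power_mono) auto
    moreover have "0 \<le> y * call_slope b" using assms by (simp add: call_slope_nonneg)
    ultimately show False using eq I by (simp add: power2_eq_square)
  qed
qed

section \<open>Seller revenue and its comparison\<close>

text \<open>Serves to integrate out the loser's value: the payment involves only the winner's, so
  the other factor is taken to be the constant 1.\<close>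

lemma cond_expect_value_pdf_pair:
  fixes g h :: "real \<Rightarrow> real"
  assumes g: "continuous_on UNIV g" and h: "continuous_on UNIV h"
  shows "cond_expect (pair_pdf value_pdf) (\<lambda>(x1, x2). g x1 * h x2) (y1, y2)
    = cond_expect value_pdf g y1 * cond_expect value_pdf h y2"
proof -
  let ?u = "\<lambda>x. g x * value_pdf y1 x" and ?v = "\<lambda>x. h x * value_pdf y2 x"
  have u: "integrable lborel ?u" and v: "integrable lborel ?v"
    by (rule integrable_mult_value_pdf, fact)+
  have [measurable]: "?u \<in> borel_measurable borel" "?v \<in> borel_measurable borel"
    using u v by (auto dest: borel_measurable_integrable)
  have "integrable (lborel \<Otimes>\<^sub>M lborel) (\<lambda>(x1, x2). ?u x1 * ?v x2)"
  proof (rule lborel_pair.Fubini_integrable)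
    show "integrable lborel (\<lambda>x. \<integral>x'. norm (case (x, x') of (x1, x2) \<Rightarrow> ?u x1 * ?v x2) \<partial>lborel)"
      using Bochner_Integration.integrable_norm[OF u] by (simp add: abs_mult)
  qed (use v in \<open>auto intro: integrable_mult_right\<close>)
  from lborel_pair.integral_fst'[OF this, symmetric]
  have "(\<integral>z. (case z of (x1, x2) \<Rightarrow> ?u x1 * ?v x2) \<partial>(lborel \<Otimes>\<^sub>M lborel))
      = integral\<^sup>L lborel ?u * integral\<^sup>L lborel ?v"
    by simp
  moreover have "(\<lambda>x. (case x of (x1, x2) \<Rightarrow> g x1 * h x2) * pair_pdf value_pdf (y1, y2) x)
      = (\<lambda>(x1, x2). ?u x1 * ?v x2)"
    by (auto simp: pair_pdf_def fun_eq_iff)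
  ultimately show ?thesis
    unfolding cond_expect_def by (simp add: lborel_prod)
qed

text \<open>Strictly increasing bids let the order of the signals decide the winner and make the
  lower bid that of the lower signal.\<close>

lemma seller_revenue_eq:
  fixes \<phi> :: "real \<Rightarrow> real \<Rightarrow> real"
  assumes mono: "strict_mono_on {0..1} (equilibrium_bid value_pdf \<phi> B I)"
    and c: "\<And>b. continuous_on UNIV (\<lambda>x. \<phi> x b)"
    and y: "y1 \<in> {0..1}" "y2 \<in> {0..1}" "y1 \<noteq> y2"
  shows "seller_revenue value_pdf \<phi> B I y1 y2
    = cond_expect value_pdf (\<lambda>x. \<phi> x (equilibrium_bid value_pdf \<phi> B I (min y1 y2))) (max y1 y2)"
proof (cases "y1 < y2")
  case True
  hence "equilibrium_bid value_pdf \<phi> B I y1 < equilibrium_bid value_pdf \<phi> B I y2"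
    using y by (intro strict_mono_onD[OF mono])
  thus ?thesis
    using cond_expect_value_pdf_pair[OF continuous_on_const[of UNIV 1] c] True
    by (simp add: seller_revenue_def cond_expect_value_pdf_const)
next
  case False
  hence "y2 < y1" using y by simp
  hence "equilibrium_bid value_pdf \<phi> B I y2 < equilibrium_bid value_pdf \<phi> B I y1"
    using y by (intro strict_mono_onD[OF mono])
  thus ?thesis
    using cond_expect_value_pdf_pair[OF c continuous_on_const[of UNIV 1]] False
    by (simp add: seller_revenue_def cond_expect_value_pdf_const)
qed

text \<open>Both revenues are affine in \<open>yi\<close> and agree at \<open>yi = yj\<close>, where
  each equals \<open>1/2 + yj/54 - I\<close> by zero profit. Only the slopes need comparing: 1/54 -
  \<open>call_slope b\<close> for debt, (1 - I/m)/54 for equity, with m the mean at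
  \<open>yj\<close>.\<close>

lemma equity_revenue_less_debt_revenue:
  assumes b: "5/24 \<le> b" "b \<le> 1" and eq: "(1 - b)^2 / 2 + yj * call_slope b = I"
    and y: "0 \<le> yj" "yj < yi" "yj \<le> 1" and I: "1/4 \<le> I"
  shows "cond_expect value_pdf (\<lambda>x. equity x (1 - I / (1/2 + yj/54))) yi
    < cond_expect value_pdf (\<lambda>x. debt x b) yi"
proof -
  let ?m = "1/2 + yj/54"
  have m: "0 < ?m" "?m \<le> 28/54" using y by auto
  have "1/126 \<le> I / (54 * ?m)" using m I by (simp add: field_simps)
  hence "call_slope b < I / (54 * ?m)" using call_slope_less[OF b(1)] by linarith
  hence "0 < (yi - yj) * (I / (54 * ?m) - call_slope b)"
    using y by simp
  also have "\<dots> = (1/2 + yi/54) - ((1 - b)^2 / 2 + yi * call_slope b)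
      - (1 - I / ?m) * (1/2 + yi/54)"
  proof -
    have "I * (1/2 + yi/54) / ?m = I + (yi - yj) * (I / (54 * ?m))"
      using m by (simp add: field_simps)
    thus ?thesis unfolding eq[symmetric] by (simp add: algebra_simps)
  qed
  also have "\<dots> = cond_expect value_pdf (\<lambda>x. debt x b) yi
      - cond_expect value_pdf (\<lambda>x. equity x (1 - I / ?m)) yi"
    using b by (simp add: cond_expect_debt cond_expect_equity)
  finally show ?thesis by simp
qed

theorem proposition2:
  fixes M :: "'a measure" and X Y :: "nat \<Rightarrow> 'a \<Rightarrow> real"
  assumes "prob_space M"
    and "prob_space.indep_var M borel (\<lambda>\<omega>. (X 1 \<omega>, Y 1 \<omega>)) borel (\<lambda>\<omega>. (X 2 \<omega>, Y 2 \<omega>))"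
    and "distr M borel (\<lambda>\<omega>. (X 1 \<omega>, Y 1 \<omega>)) = distr M borel (\<lambda>\<omega>. (X 2 \<omega>, Y 2 \<omega>))"
    and "\<And>n. n \<in> {1, 2} \<Longrightarrow> distr M borel (Y n) = uniform_measure lborel {0..1}"
    and "\<And>n. n \<in> {1, 2} \<Longrightarrow> cond_pdf M (X n) (Y n) value_pdf"
  shows "\<exists>I0 I1. 0 < I0 \<and> I0 < I1 \<and>
    (\<forall>I\<in>{I0..I1}. \<forall>\<delta>>0.
      (\<forall>y\<in>{0..1}. cond_expect value_pdf (\<lambda>x. \<delta> * x - I) y \<le> 0) \<longrightarrow>
      (let bd = equilibrium_bid value_pdf debt debt_bids I;
           be = equilibrium_bid value_pdf equity (equity_bids \<delta>) I
       in (\<forall>y\<in>{0..1}. \<exists>!b. zero_profit_bid value_pdf debt debt_bids I y b) \<and>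
          (\<forall>y\<in>{0..1}. \<exists>!b. zero_profit_bid value_pdf equity (equity_bids \<delta>) I y b) \<and>
          strict_mono_on {0..1} bd \<and> strict_mono_on {0..1} be \<and>
          (\<forall>y1\<in>{0..1}. \<forall>y2\<in>{0..1}. y1 \<noteq> y2 \<longrightarrow>
             seller_revenue value_pdf debt debt_bids I y1 y2 >
             seller_revenue value_pdf equity (equity_bids \<delta>) I y1 y2) \<and>
          (\<forall>yi\<in>{0..1}. \<forall>yj\<in>{0..1}. yj < yi \<longrightarrow>
             cond_expect value_pdf (\<lambda>x. debt x (bd yj)) yi >
             cond_expect value_pdf (\<lambda>x. equity x (be yj)) yi)))"
proof -
  have main: "let bd = equilibrium_bid value_pdf debt debt_bids I;
           be = equilibrium_bid value_pdf equity (equity_bids \<delta>) I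
       in (\<forall>y\<in>{0..1}. \<exists>!b. zero_profit_bid value_pdf debt debt_bids I y b) \<and>
          (\<forall>y\<in>{0..1}. \<exists>!b. zero_profit_bid value_pdf equity (equity_bids \<delta>) I y b) \<and>
          strict_mono_on {0..1} bd \<and> strict_mono_on {0..1} be \<and>
          (\<forall>y1\<in>{0..1}. \<forall>y2\<in>{0..1}. y1 \<noteq> y2 \<longrightarrow>
             seller_revenue value_pdf debt debt_bids I y1 y2 >
             seller_revenue value_pdf equity (equity_bids \<delta>) I y1 y2) \<and>
          (\<forall>yi\<in>{0..1}. \<forall>yj\<in>{0..1}. yj < yi \<longrightarrow>
             cond_expect value_pdf (\<lambda>x. debt x (bd yj)) yi >
             cond_expect value_pdf (\<lambda>x. equity x (be yj)) yi)"
    if I: "I \<in> {1/4..3/10}" and "\<forall>y\<in>{0..1}. cond_expect value_pdf (\<lambda>x. \<delta> * x - I) y \<le> 0"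
    for I \<delta> :: real
  proof -
    define bd where "bd = equilibrium_bid value_pdf debt debt_bids I"
    define be where "be = equilibrium_bid value_pdf equity (equity_bids \<delta>) I"
    \<comment> \<open>The smallness condition on \<open>\<delta>\<close>, with the expectation
      evaluated, is what places the equity bid in the admissible set.\<close>
    have \<delta>: "\<delta> * (1/2 + y/54) \<le> I" if "y \<in> {0..1}" for y
    proof -
      have "cond_expect value_pdf (\<lambda>x. \<delta> * x - I) y = \<delta> * (1/2 + y/54) - I"
        by (simp add: cond_expect_value_pdf_diff continuous_on_mult_left cond_expect_cmult
            cond_expect_value_pdf_id cond_expect_value_pdf_const)
      thus ?thesis using that \<open>\<forall>y\<in>{0..1}. _\<close> by fastforce
    qed
    have ex1d: "\<exists>!b. zero_profit_bid value_pdf debt debt_bids I y b" if "y \<in> {0..1}" for y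
      using that I by (intro ex1_zero_profit_bid_debt) auto
    have eq_bid_iff: "zero_profit_bid value_pdf equity (equity_bids \<delta>) I y b \<longleftrightarrow> b = 1 - I / (1/2 + y/54)"
      if "y \<in> {0..1}" for y b
      using that I \<delta>[OF that] by (intro zero_profit_bid_equity_iff) auto
    have be: "be y = 1 - I / (1/2 + y/54)" if "y \<in> {0..1}" for y
      using eq_bid_iff[OF that] by (simp add: be_def equilibrium_bid_def)
    have bd: "bd y \<in> {0..1}" "(1 - bd y)^2 / 2 + y * call_slope (bd y) = I" if "y \<in> {0..1}" for y
      using theI'[OF ex1d[OF that]] unfolding bd_def equilibrium_bid_def zero_profit_bid_debt_iff
      by blast+
    have bd_bounds: "5/24 \<le> bd y" "bd y < 1/3" if "y \<in> {0..1}" for y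
      using debt_bid_bounds[of y "bd y" I] bd[OF that] that I by auto
    \<comment> \<open>If \<open>bd z \<le> bd y\<close>, the call with strike \<open>bd y\<close> is
      worth at most \<open>I\<close> at signal \<open>z\<close>. But it is worth exactly
      \<open>I\<close> at \<open>y\<close>, and its value strictly increases with the signal because
      \<open>bd y < 1/3\<close>.\<close>
    have mono_d: "strict_mono_on {0..1} bd"
    proof (rule strict_mono_onI, rule ccontr)
      fix y z :: real assume yz: "y \<in> {0..1}" "z \<in> {0..1}" "y < z" and "\<not> bd y < bd z"
      hence "(1 - bd y)^2 / 2 + z * call_slope (bd y) \<le> (1 - bd z)^2 / 2 + z * call_slope (bd z)"
        using call_value_strict_antimono[of z "bd z" "bd y"] bd(1)[OF yz(1)] bd(1)[OF yz(2)]
        by (cases "bd y = bd z") auto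
      moreover have "y * call_slope (bd y) < z * call_slope (bd y)"
        using yz bd_bounds[OF yz(1)] by (intro mult_strict_right_mono call_slope_pos) auto
      ultimately show False using bd(2)[OF yz(1)] bd(2)[OF yz(2)] by simp
    qed
    have mono_e: "strict_mono_on {0..1} be"
    proof (rule strict_mono_onI)
      fix y z :: real assume yz: "y \<in> {0..1}" "z \<in> {0..1}" "y < z"
      have "I / (1/2 + z/54) < I / (1/2 + y/54)"
        using yz I by (intro divide_strict_left_mono mult_pos_pos) auto
      thus "be y < be z" using yz by (simp add: be)
    qed
    have rev: "cond_expect value_pdf (\<lambda>x. equity x (be yj)) yi
        < cond_expect value_pdf (\<lambda>x. debt x (bd yj)) yi"
      if "yi \<in> {0..1}" "yj \<in> {0..1}" "yj < yi" for yi yj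
      using equity_revenue_less_debt_revenue[of "bd yj" yj I yi] bd[OF that(2)]
        bd_bounds[OF that(2)] that I by (simp add: be)
    have "seller_revenue value_pdf equity (equity_bids \<delta>) I y1 y2
        < seller_revenue value_pdf debt debt_bids I y1 y2"
      if "y1 \<in> {0..1}" "y2 \<in> {0..1}" "y1 \<noteq> y2" for y1 y2
      using rev[of "max y1 y2" "min y1 y2"] that
        seller_revenue_eq[OF mono_d[unfolded bd_def] continuous_on_debt that]
        seller_revenue_eq[OF mono_e[unfolded be_def] continuous_on_equity that]
      by (auto simp: bd_def be_def max_def min_def)
    thus ?thesis
      unfolding Let_def bd_def[symmetric] be_def[symmetric]
      using ex1d eq_bid_iff mono_d mono_e rev by auto
  qed
  show ?thesis
    by (rule exI[of _ "1/4"], rule exI[of _ "3/10"]) (use main in auto)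
qed

end
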